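(* Let $G$ be a conflict graph of size $n$ for a set $F$ of clauses under an assignment $\alpha$, and let $\mathcal H$ be a series-parallel decomposition of $G$. Then there is a regWRTI proof $T$ from $F$ of size at most $n^2$ such that every learnable clause of $\mathcal H$ is an input-derived clause in $T$, and the final clause of $T$ equals the conflict clause $\mathrm{CC}(G)$. Furthermore, $T$ uses as resolution variables only variables that occur (possibly negated) as nodes of $G$ that are not leaves of $G$.
   Context: Literals: variables $x$ and negations $\overline x$; clauses: finite sets of literals. An assignment $\alpha$ is a partial map from variables to $\{0,1\}$, with $\alpha(\overline x)=1-\alpha(x)$. Conflict graph for $F$ under $\alpha$: a dag $G=(V\cup\{\Box\},E)$, $V$ a set of literals, such that (a) each $l\in V$ either has in-degree $0$ and $\alpha(l)=1$, or there is a clause $C\in F$ with $C=\{l\}\cup\{l':(\overline{l'},l)\in E\}$ (denoted $C_l$); (b) there is a unique variable $x$ with $x,\overline x\in V$; (c) $\Box$ has exactly the two incoming edges $(x,\Box),(\overline x,\Box)$; (d) $\Box$ is the only node of out-degree $0$. Its size is its number of nodes. $\mathrm{leaves}(G)$ is the set of in-degree-$0$ nodes. The conflict clause is $\mathrm{CC}(G)=\{\overline l: l\in\mathrm{leaves}(G)\}$. For a non-leaf literal node $l$, $G_l$ is the subgraph of nodes having a path to $l$ (with induced edges), and the induced clause is $\mathrm{IC}(l,G)=\{l\}\cup\{\overline{l'}:l'\in\mathrm{leaves}(G_l)\}$ (it is said not to exist if $G_l$ consists of $l$ alone). $H=(W,E')$ is a subconflict graph of $G=(V,E)$ if $H$ is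 a conflict graph with $W\subseteq V$, $E'\subseteq E$, and each non-leaf vertex of $H$ has the same in-degree in $H$ as in $G$; it is proper if there is no path in $G$ from a non-leaf vertex of $H$ to a vertex of $\mathrm{leaves}(H)$. A decomposition of $G$ is a sequence $H_0\subset H_1\subset\cdots\subset H_k$, $k\ge1$, of distinct proper subconflict graphs with $H_k=G$ and $H_0$ the subgraph on $\Box$ and its two predecessors $x,\overline x$. A series-parallel decomposition $\mathcal H$ is a decomposition together with, for each $0\le i<k$, a sequence $H_i=H_{i,0}\subset H_{i,1}\subset\cdots\subset H_{i,m_i}=H_{i+1}$ of distinct proper subconflict graphs. Its learnable clauses are: $\mathrm{CC}(H_{0,j})$ for $1\le j\le m_0$; and, for each $0<i<k$, $0<j\le m_i$ and $l\in\mathrm{leaves}(H_i)\setminus\mathrm{leaves}(H_{i,j})$, the (existing) induced clause $\mathrm{IC}(l,H_{i,j})$. regWRTI: Resolution infers $(C_0\setminus\{x\})\cup(C_1\setminus\{\overline x\})$ from $C_0\ni x$, $C_1\ni\overline x$; w-resolution infers the same from arbitrary $C_0,C_1$. A WRTL proof from $F$ is an ordered binary tree $T$ with post-order $<_T$ (left subtree before right subtree before the node) where each leaf $v$ is labeled by a clause of $F$ or by a clause labeling some node $u<_T v$ (lemma), and each internal node by a variable $x$ and the w-resolvent on $x$ of its children's clauses. A node is input-derived (and its clause an input-derived clause) if its subtree is an input resolution tree: a tree using only genuine resolution in which every internal node has a leaf child. WRTI: WRTL where every lemma leaf $v$ is labeled by a clause of an input-derived node $u<_T v$. Regular: no leaf-to-root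 path contains two inferences on the same variable. Size = number of nodes. *)

theory Defs
  imports "Graph_Theory.Graph_Theory"
begin

section \<open>Literals, clauses, assignments\<close>

datatype 'v lit = Pos (var: 'v) | Neg (var: 'v)

primrec neg :: "'v lit \<Rightarrow> 'v lit" where
  "neg (Pos x) = Neg x"
| "neg (Neg x) = Pos x"

text \<open>Clauses are finite sets of literals; finiteness of the clauses of a formula is
  assumed explicitly where a formula is introduced.\<close>

type_synonym 'v clause = "'v lit set"

type_synonym 'v assignment = "'v \<rightharpoonup> bool"

primrec lit_val :: "'v assignment \<Rightarrow> 'v lit \<Rightarrow> bool option" where
  "lit_val \<alpha> (Pos x) = \<alpha> x"
| "lit_val \<alpha> (Neg x) = map_option Not (\<alpha> x)"


section \<open>Conflict graphs\<close>

datatype 'v node = Box | Lit "'v lit"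

type_synonym 'v graph = "'v node pair_pre_digraph"

text \<open>The in-degree-0 nodes, as literals. In a conflict graph the node \<open>Box\<close> has in-degree 2,
  so nothing is lost. The argument is a general digraph so that this also applies to
  induced subgraphs, which the library forms as general digraphs.\<close>

definition leaves :: "('v node, 'e) pre_digraph \<Rightarrow> 'v lit set" where
  "leaves G = {l. Lit l \<in> verts G \<and> in_degree G (Lit l) = 0}"

text \<open>Conflict graphs with a parameter \<open>P\<close> for the condition imposed on in-degree-0 literals
  that are not justified by a unit clause.
  Predecessors of a literal node are themselves literal nodes, since \<open>Box\<close> has out-degree 0.\<close>

definition conflict_graph_wrt :: "'v clause set \<Rightarrow> ('v lit \<Rightarrow> bool) \<Rightarrow> 'v graph \<Rightarrow> bool" where
  "conflict_graph_wrt F P G \<longleftrightarrow>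
     pair_fin_digraph G \<and> acyclic (parcs G) \<and> Box \<in> pverts G \<and>
     (\<forall>l. Lit l \<in> pverts G \<longrightarrow>
        (in_degree G (Lit l) = 0 \<and> P l) \<or>
        (\<exists>C\<in>F. C = {l} \<union> {l'. (Lit (neg l'), Lit l) \<in> parcs G})) \<and>
     (\<exists>!x. Lit (Pos x) \<in> pverts G \<and> Lit (Neg x) \<in> pverts G) \<and>
     (\<exists>x. Lit (Pos x) \<in> pverts G \<and> Lit (Neg x) \<in> pverts G \<and>
        {u. (u, Box) \<in> parcs G} = {Lit (Pos x), Lit (Neg x)}) \<and>
     {v \<in> pverts G. out_degree G v = 0} = {Box}"

definition conflict_graph :: "'v clause set \<Rightarrow> 'v assignment \<Rightarrow> 'v graph \<Rightarrow> bool" where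
  "conflict_graph F \<alpha> G \<longleftrightarrow> conflict_graph_wrt F (\<lambda>l. lit_val \<alpha> l = Some True) G"

definition CC :: "'v graph \<Rightarrow> 'v clause" where
  "CC G = {neg l | l. l \<in> leaves G}"

definition graph_to :: "'v graph \<Rightarrow> 'v lit \<Rightarrow> ('v node, 'v node \<times> 'v node) pre_digraph" where
  "graph_to G l = with_proj G \<restriction> {v. v \<rightarrow>\<^sup>*\<^bsub>G\<^esub> Lit l}"

definition IC :: "'v lit \<Rightarrow> 'v graph \<Rightarrow> 'v clause" where
  "IC l G = {l} \<union> {neg l' | l'. l' \<in> leaves (graph_to G l)}"

definition IC_exists :: "'v lit \<Rightarrow> 'v graph \<Rightarrow> bool" where
  "IC_exists l G \<longleftrightarrow> Lit l \<in> pverts G \<and> verts (graph_to G l) \<noteq> {Lit l}"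


section \<open>Subconflict graphs and decompositions\<close>

text \<open>The leaves of a subconflict graph need not be satisfied by the assignment \<open>\<alpha>\<close>
  of the ambient graph: in general they are literals derived in the ambient graph, and for the
  smallest subconflict graph they are the complementary literals \<open>x\<close> and \<open>\<not>x\<close>, which no
  assignment satisfies simultaneously. Hence no condition is imposed on them.\<close>

definition subconflict_graph :: "'v clause set \<Rightarrow> 'v graph \<Rightarrow> 'v graph \<Rightarrow> bool" where
  "subconflict_graph F H G \<longleftrightarrow>
     conflict_graph_wrt F (\<lambda>_. True) H \<and> subgraph H G \<and>
     (\<forall>v\<in>pverts H. in_degree H v \<noteq> 0 \<longrightarrow> in_degree H v = in_degree G v)"

definition proper_subconflict_graph :: "'v clause set \<Rightarrow> 'v graph \<Rightarrow> 'v graph \<Rightarrow> bool" where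
  "proper_subconflict_graph F H G \<longleftrightarrow>
     subconflict_graph F H G \<and>
     \<not> (\<exists>v\<in>pverts H. \<exists>l\<in>leaves H. in_degree H v \<noteq> 0 \<and> v \<rightarrow>\<^sup>*\<^bsub>G\<^esub> Lit l)"

definition strict_subgraph :: "'v graph \<Rightarrow> 'v graph \<Rightarrow> bool" where
  "strict_subgraph H G \<longleftrightarrow> subgraph H G \<and> H \<noteq> G"

text \<open>The graph \<open>H 0\<close> is specified by its nodes, \<open>Box\<close> and the two predecessors of \<open>Box\<close>.
  Being a subconflict graph it contains both arcs into \<open>Box\<close>; there is no other arc, except
  possibly one between \<open>x\<close> and \<open>\<not>x\<close> if \<open>G\<close> happens to contain such an arc.\<close>

definition decomposition :: "'v clause set \<Rightarrow> 'v graph \<Rightarrow> nat \<Rightarrow> (nat \<Rightarrow> 'v graph) \<Rightarrow> bool" where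
  "decomposition F G k H \<longleftrightarrow>
     1 \<le> k \<and>
     (\<forall>i\<le>k. proper_subconflict_graph F (H i) G) \<and>
     (\<forall>i<k. strict_subgraph (H i) (H (Suc i))) \<and>
     H k = G \<and>
     pverts (H 0) = {Box} \<union> {v. (v, Box) \<in> parcs G}"

text \<open>\<open>K i j\<close> is the refining graph with indices \<open>i\<close> and \<open>j\<close>, for \<open>i < k\<close> and \<open>j \<le> m i\<close>.\<close>

definition series_parallel_decomposition ::
  "'v clause set \<Rightarrow> 'v graph \<Rightarrow> nat \<Rightarrow> (nat \<Rightarrow> 'v graph) \<Rightarrow>
   (nat \<Rightarrow> nat) \<Rightarrow> (nat \<Rightarrow> nat \<Rightarrow> 'v graph) \<Rightarrow> bool" where
  "series_parallel_decomposition F G k H m K \<longleftrightarrow>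
     decomposition F G k H \<and>
     (\<forall>i<k. K i 0 = H i \<and> K i (m i) = H (Suc i) \<and>
        (\<forall>j\<le>m i. proper_subconflict_graph F (K i j) G) \<and>
        (\<forall>j<m i. strict_subgraph (K i j) (K i (Suc j))))"

definition learnable_clauses ::
  "nat \<Rightarrow> (nat \<Rightarrow> 'v graph) \<Rightarrow> (nat \<Rightarrow> nat) \<Rightarrow> (nat \<Rightarrow> nat \<Rightarrow> 'v graph) \<Rightarrow> 'v clause set" where
  "learnable_clauses k H m K =
     {CC (K 0 j) | j. 1 \<le> j \<and> j \<le> m 0} \<union>
     {IC l (K i j) | i j l. 0 < i \<and> i < k \<and> 0 < j \<and> j \<le> m i \<and>
        l \<in> leaves (H i) - leaves (K i j) \<and> IC_exists l (K i j)}"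


section \<open>Resolution trees with input lemmas\<close>

text \<open>\<open>resolvent x C0 C1 D\<close>: the clause \<open>D\<close> follows from \<open>C0\<close> and \<open>C1\<close> by resolution on \<open>x\<close>.\<close>

definition w_resolvent :: "'v \<Rightarrow> 'v clause \<Rightarrow> 'v clause \<Rightarrow> 'v clause \<Rightarrow> bool" where
  "w_resolvent x C0 C1 D \<longleftrightarrow> D = (C0 - {Pos x}) \<union> (C1 - {Neg x})"

definition resolvent :: "'v \<Rightarrow> 'v clause \<Rightarrow> 'v clause \<Rightarrow> 'v clause \<Rightarrow> bool" where
  "resolvent x C0 C1 D \<longleftrightarrow> Pos x \<in> C0 \<and> Neg x \<in> C1 \<and> w_resolvent x C0 C1 D"

datatype 'v rtree =
    Leaf (root_clause: "'v clause")
  | Node "'v" (root_clause: "'v clause") "'v rtree" "'v rtree"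

text \<open>The subtrees at all nodes, in post-order. A node of \<open>T\<close> is identified with its index in
  this list, so that \<open>u <\<^sub>T v\<close> is the order of indices.\<close>

primrec postorder :: "'v rtree \<Rightarrow> 'v rtree list" where
  "postorder (Leaf C) = [Leaf C]"
| "postorder (Node x C l r) = postorder l @ postorder r @ [Node x C l r]"

definition num_nodes :: "'v rtree \<Rightarrow> nat" where
  "num_nodes T = length (postorder T)"

primrec is_leaf :: "'v rtree \<Rightarrow> bool" where
  "is_leaf (Leaf C) = True"
| "is_leaf (Node x C l r) = False"

text \<open>The order of the children is only relevant for the post-order; either child may
  provide the premise from which \<open>Pos x\<close> is removed.\<close>

primrec w_resolution_tree :: "'v rtree \<Rightarrow> bool" where
  "w_resolution_tree (Leaf C) = True"
| "w_resolution_tree (Node x C l r) \<longleftrightarrow>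
     (w_resolvent x (root_clause l) (root_clause r) C \<or>
      w_resolvent x (root_clause r) (root_clause l) C) \<and>
     w_resolution_tree l \<and> w_resolution_tree r"

primrec input_tree :: "'v rtree \<Rightarrow> bool" where
  "input_tree (Leaf C) = True"
| "input_tree (Node x C l r) \<longleftrightarrow>
     (resolvent x (root_clause l) (root_clause r) C \<or>
      resolvent x (root_clause r) (root_clause l) C) \<and>
     (is_leaf l \<or> is_leaf r) \<and> input_tree l \<and> input_tree r"

definition WRTL :: "'v clause set \<Rightarrow> 'v rtree \<Rightarrow> bool" where
  "WRTL F T \<longleftrightarrow> w_resolution_tree T \<and>
     (\<forall>v<length (postorder T). is_leaf (postorder T ! v) \<longrightarrow>
        root_clause (postorder T ! v) \<in> F \<or>
        (\<exists>u<v. root_clause (postorder T ! u) = root_clause (postorder T ! v)))"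

definition WRTI :: "'v clause set \<Rightarrow> 'v rtree \<Rightarrow> bool" where
  "WRTI F T \<longleftrightarrow> WRTL F T \<and>
     (\<forall>v<length (postorder T). is_leaf (postorder T ! v) \<longrightarrow>
        root_clause (postorder T ! v) \<notin> F \<longrightarrow>
        (\<exists>u<v. root_clause (postorder T ! u) = root_clause (postorder T ! v) \<and>
               input_tree (postorder T ! u)))"

text \<open>The sequences of resolution variables along the paths between the root and the leaves.\<close>

primrec path_vars :: "'v rtree \<Rightarrow> 'v list set" where
  "path_vars (Leaf C) = {[]}"
| "path_vars (Node x C l r) = (#) x ` (path_vars l \<union> path_vars r)"

definition regular_tree :: "'v rtree \<Rightarrow> bool" where
  "regular_tree T \<longleftrightarrow> (\<forall>xs\<in>path_vars T. distinct xs)"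

definition regWRTI :: "'v clause set \<Rightarrow> 'v rtree \<Rightarrow> bool" where
  "regWRTI F T \<longleftrightarrow> WRTI F T \<and> regular_tree T"

primrec res_vars :: "'v rtree \<Rightarrow> 'v set" where
  "res_vars (Leaf C) = {}"
| "res_vars (Node x C l r) = {x} \<union> res_vars l \<union> res_vars r"

definition input_derived_clauses :: "'v rtree \<Rightarrow> 'v clause set" where
  "input_derived_clauses T = {root_clause t | t. t \<in> set (postorder T) \<and> input_tree t}"

end

theory Submission
  imports Defs
begin

text \<open>
  A subconflict graph of \<open>G\<close> is proper exactly if its set of implied (non-leaf) literals is closed
  under successors in \<open>G\<close>, and this up-set determines the graph. Hence the implied literals of \<open>G\<close>
  can be listed sinks first such that every graph of the decomposition corresponds to an initial
  segment. The first literal \<open>t\<close> of the list is a predecessor of \<open>Box\<close>. Resolving its clause with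
  the clauses of the following literals, in this order, is an input resolution that passes through
  all conflict clauses up to that of the first graph \<open>H 1\<close>.

  To pass from the conflict clause of \<open>H i\<close> to that of \<open>H (i + 1)\<close>, resolve it on each leaf \<open>l\<close> of
  \<open>H i\<close> that is implied in \<open>H (i + 1)\<close>, with an input derivation of the clause induced by \<open>l\<close>. Done
  sinks first, that derivation passes through the clauses that \<open>l\<close> induces in the intermediate graphs.
  The leaves themselves are treated sources first, so that a leaf \<open>l'\<close> occurring in the derivation
  for \<open>l\<close> is never resolved on again further down; this gives regularity. Both \<open>x\<close> and its negation
  may be implied, but one of them is \<open>t\<close>, which is never resolved on. No lemmas are needed: a step
  with \<open>d\<close> new literals costs at most \<open>d (d + 1)\<close> nodes, which preserves the bound \<open>(c + 1)\<^sup>2\<close> on the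
  size, where \<open>c\<close> is the number of implied literals.
\<close>

section \<open>Literals and resolution trees\<close>

lemma neg_neg [simp]: "neg (neg l) = l"
  by (cases l) auto

lemma neg_eq_iff [simp]: "neg a = neg b \<longleftrightarrow> a = b"
  by (metis neg_neg)

lemma neg_neq [simp]: "neg l \<noteq> l" "l \<noteq> neg l"
  by (cases l; simp)+

lemma mem_neg_image_iff [simp]: "l \<in> neg ` A \<longleftrightarrow> neg l \<in> A"
  by (metis image_iff neg_neg)

lemma var_eq_iff: "var a = var b \<longleftrightarrow> a = b \<or> a = neg b"
  by (cases a; cases b) auto

text \<open>The pivot \<open>a\<close> is removed from the second premise and its negation from the
  first. Naming the pivot by a literal covers both polarities, since resolution trees accept their
  premises in either order.\<close>

definition resolve_on :: "'v lit \<Rightarrow> 'v rtree \<Rightarrow> 'v rtree \<Rightarrow> 'v rtree" where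
  "resolve_on a T S = Node (var a) ((root_clause T - {neg a}) \<union> (root_clause S - {a})) T S"

lemma root_clause_resolve_on [simp]:
  "root_clause (resolve_on a T S) = (root_clause T - {neg a}) \<union> (root_clause S - {a})"
  by (simp add: resolve_on_def)

lemma postorder_resolve_on [simp]:
  "postorder (resolve_on a T S) = postorder T @ postorder S @ [resolve_on a T S]"
  by (simp add: resolve_on_def)

lemma resolve_on_neq_Leaf [simp]: "Leaf C \<noteq> resolve_on a T S"
  by (simp add: resolve_on_def)

lemma w_resolution_tree_resolve_on [simp]:
  "w_resolution_tree (resolve_on a T S) \<longleftrightarrow> w_resolution_tree T \<and> w_resolution_tree S"
  by (cases a) (auto simp: resolve_on_def w_resolvent_def)

lemma input_tree_resolve_on:
  assumes "input_tree T" "neg a \<in> root_clause T" "a \<in> C"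
  shows "input_tree (resolve_on a T (Leaf C))"
  using assms by (cases a) (auto simp: resolve_on_def resolvent_def w_resolvent_def)

lemma num_nodes_resolve_on [simp]:
  "num_nodes (resolve_on a T S) = num_nodes T + num_nodes S + 1"
  by (simp add: num_nodes_def)

lemma res_vars_resolve_on [simp]:
  "res_vars (resolve_on a T S) = insert (var a) (res_vars T \<union> res_vars S)"
  by (simp add: resolve_on_def)

lemma path_vars_subset_res_vars: "xs \<in> path_vars T \<Longrightarrow> set xs \<subseteq> res_vars T"
  by (induction T arbitrary: xs) fastforce+

lemma regular_tree_resolve_on:
  assumes "regular_tree T" "regular_tree S" "var a \<notin> res_vars T" "var a \<notin> res_vars S"
  shows "regular_tree (resolve_on a T S)"
  using assms path_vars_subset_res_vars
  by (fastforce simp: regular_tree_def resolve_on_def)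

lemma self_in_postorder [simp]: "T \<in> set (postorder T)"
  by (cases T) auto

text \<open>The condition on leaves does not refer to positions in the post-order, so it survives
  the combination of trees.\<close>

definition regular_derivation :: "'v clause set \<Rightarrow> 'v rtree \<Rightarrow> bool" where
  "regular_derivation F T \<longleftrightarrow>
     w_resolution_tree T \<and> regular_tree T \<and> (\<forall>C. Leaf C \<in> set (postorder T) \<longrightarrow> C \<in> F)"

lemma regular_derivation_resolve_on:
  assumes "regular_derivation F T" "regular_derivation F S"
    and "var a \<notin> res_vars T" "var a \<notin> res_vars S"
  shows "regular_derivation F (resolve_on a T S)"
  using assms by (auto simp: regular_derivation_def intro: regular_tree_resolve_on)

lemma regular_derivation_imp_regWRTI:
  assumes "regular_derivation F T"
  shows "regWRTI F T"
proof -
  have "root_clause (postorder T ! v) \<in> F"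
    if "v < length (postorder T)" "is_leaf (postorder T ! v)" for v
    using that assms nth_mem[OF that(1)]
    by (cases "postorder T ! v") (auto simp: regular_derivation_def)
  then show ?thesis
    using assms by (auto simp: regWRTI_def WRTI_def WRTL_def regular_derivation_def)
qed


section \<open>Up-sets of implied literals\<close>

text \<open>A conflict graph reduced to its literals: \<open>N\<close> are the implied ones,
  \<open>P\<close> gives the predecessors of an implied literal, \<open>x\<close> is the conflict
  variable, and the rank \<open>d\<close> decreases along arcs. The right-hand side of
  \<open>N_subset\<close> stands for all literal nodes.\<close>

locale implication_dag =
  fixes F :: "'v clause set" and N :: "'v lit set" and P :: "'v lit \<Rightarrow> 'v lit set"
    and x :: 'v and d :: "'v lit \<Rightarrow> nat"
  assumes finite_N: "finite N"
    and N_subset: "N \<subseteq> {Pos x, Neg x} \<union> \<Union> (P ` N)"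
    and clause_in_F: "a \<in> N \<Longrightarrow> insert a (neg ` P a) \<in> F"
    and rank_less: "b \<in> N \<Longrightarrow> a \<in> P b \<Longrightarrow> d b < d a"
    and unique_conflict:
      "a \<in> {Pos x, Neg x} \<union> \<Union> (P ` N) \<Longrightarrow> neg a \<in> {Pos x, Neg x} \<union> \<Union> (P ` N) \<Longrightarrow> var a = x"
begin

definition ancestors :: "'v lit \<Rightarrow> 'v lit set" where
  "ancestors b = {a. (a, b) \<in> {(a, b). b \<in> N \<and> a \<in> P b}\<^sup>*}"

definition up_set :: "'v lit set \<Rightarrow> bool" where
  "up_set U \<longleftrightarrow> U \<subseteq> N \<and> (\<forall>a\<in>U. \<forall>b\<in>N. a \<in> P b \<longrightarrow> b \<in> U)"

text \<open>The leaves of the proper subconflict graph with implied literals \<open>U\<close>;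
  negated, they form its conflict clause.\<close>

definition boundary :: "'v lit set \<Rightarrow> 'v lit set" where
  "boundary U = {Pos x, Neg x} \<union> \<Union> (P ` U) - U"

text \<open>The clause that \<open>l\<close> induces in the same graph, for \<open>l\<close> in
  \<open>U\<close>.\<close>

definition induced :: "'v lit set \<Rightarrow> 'v lit \<Rightarrow> 'v clause" where
  "induced U l = insert l (neg ` (\<Union> (P ` (ancestors l \<inter> U)) - U))"

section \<open>Ancestors, complementary literals and topological lists\<close>

lemma self_ancestor [simp]: "a \<in> ancestors a"
  by (simp add: ancestors_def)

lemma pred_ancestor: "b \<in> N \<Longrightarrow> a \<in> P b \<Longrightarrow> b \<in> ancestors c \<Longrightarrow> a \<in> ancestors c"
  unfolding ancestors_def by (auto intro: converse_rtrancl_into_rtrancl)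

lemma ancestor_cases:
  assumes "a \<in> ancestors c"
  obtains "a = c" | b where "b \<in> N" "a \<in> P b" "b \<in> ancestors c"
  using assms unfolding ancestors_def by (auto elim: converse_rtranclE)

lemma ancestor_rank: "a \<in> ancestors b \<Longrightarrow> a = b \<or> d b < d a"
  unfolding ancestors_def mem_Collect_eq
  by (induction rule: converse_rtrancl_induct) (auto dest: rank_less)

lemma up_set_ancestor:
  assumes "up_set U" "a \<in> ancestors b" "a \<in> U"
  shows "b \<in> U"
  using assms(2,3) unfolding ancestors_def mem_Collect_eq
  by (induction rule: converse_rtrancl_induct) (use assms(1) in \<open>auto simp: up_set_def\<close>)

lemma not_self_pred: "a \<in> N \<Longrightarrow> a \<notin> P a"
  using rank_less by blast

lemma neg_not_pred:
  assumes "a \<in> N" "var a \<noteq> x"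
  shows "neg a \<notin> P a"
proof
  assume "neg a \<in> P a"
  with assms have "neg a \<in> {Pos x, Neg x} \<union> \<Union> (P ` N)" by auto
  then show False using unique_conflict[of a] N_subset assms by auto
qed

text \<open>Take \<open>t\<close> of least rank in \<open>U\<close>. An implied successor would lie
  in \<open>U\<close> with smaller rank, so the arc leaving \<open>t\<close> goes to
  \<open>Box\<close>.\<close>

lemma up_set_conflict_literal:
  assumes "up_set U" "U \<noteq> {}"
  obtains t where "t \<in> U" "var t = x"
proof -
  have "finite U" using assms finite_N by (auto simp: up_set_def intro: finite_subset)
  then obtain t where t: "t \<in> U" "\<And>u. u \<in> U \<Longrightarrow> d t \<le> d u"
    using assms(2) by (metis arg_min_if_finite(1) arg_min_least)
  have "t \<notin> P b" if "b \<in> N" for b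
    using t that assms(1) rank_less[of b t] unfolding up_set_def by fastforce
  moreover have "t \<in> N" using t assms by (auto simp: up_set_def)
  ultimately have "t \<in> {Pos x, Neg x}" using N_subset by blast
  then show thesis using that t by auto
qed

text \<open>If \<open>neg a\<close> were an ancestor of \<open>a\<close>, both would be nodes, so
  \<open>a\<close> would be a literal of \<open>x\<close>. As \<open>U\<close> contains a literal of
  \<open>x\<close> but not \<open>a\<close>, it would contain \<open>neg a\<close>, and then also
  its descendant \<open>a\<close>.\<close>

lemma neg_not_ancestor:
  assumes "up_set U" "U \<noteq> {}" "a \<in> N" "a \<notin> U"
  shows "neg a \<notin> ancestors a"
proof
  assume anc: "neg a \<in> ancestors a"
  then obtain b where "b \<in> N" "neg a \<in> P b" by (cases rule: ancestor_cases) auto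
  then have "var a = x" using unique_conflict[of a] N_subset assms(3) by blast
  moreover obtain t where "t \<in> U" "var t = x"
    using up_set_conflict_literal assms by blast
  ultimately have "neg a \<in> U" using assms(4) by (metis neg_neg var_eq_iff)
  then show False using up_set_ancestor assms(1,4) anc by blast
qed

text \<open>Sort each difference of consecutive sets by rank and concatenate. No literal of an
  earlier block is an ancestor of one in a later block, since an up-set contains the implied
  descendants of its members.\<close>

lemma topological_list:
  assumes "\<And>j. j \<le> m \<Longrightarrow> up_set (W j)" "\<And>j. j < m \<Longrightarrow> W j \<subseteq> W (Suc j)"
  shows "\<exists>M. distinct M \<and> set M = W m - W 0 \<and> sorted_wrt (\<lambda>a b. a \<notin> ancestors b) M \<and>
             (\<forall>j\<le>m. \<exists>xs ys. M = xs @ ys \<and> set xs = W j - W 0)"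
  using assms
proof (induction m)
  case 0
  show ?case by (intro exI[of _ "[]"]) auto
next
  case (Suc m)
  then obtain M where M: "distinct M" "set M = W m - W 0"
    "sorted_wrt (\<lambda>a b. a \<notin> ancestors b) M"
    "\<And>j. j \<le> m \<Longrightarrow> \<exists>xs ys. M = xs @ ys \<and> set xs = W j - W 0"
    by (metis less_Suc_eq le_SucI)
  have base: "W 0 \<subseteq> W j" if "j \<le> Suc m" for j
    using that
  proof (induction j)
    case (Suc j)
    then show ?case using Suc.prems \<open>\<And>j. j < Suc m \<Longrightarrow> W j \<subseteq> W (Suc j)\<close>[of j] by auto
  qed auto
  have up: "up_set (W m)" "up_set (W (Suc m))" "W m \<subseteq> W (Suc m)"
    using Suc.prems by auto
  have "finite (W (Suc m) - W m)"
    using up finite_N by (auto simp: up_set_def intro: finite_subset)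
  then obtain L0 where "set L0 = W (Suc m) - W m" "distinct L0"
    using finite_distinct_list by metis
  then obtain L where L: "set L = W (Suc m) - W m" "distinct L"
    "sorted_wrt (\<lambda>a b. d a \<le> d b) L"
    by (metis sorted_map sorted_sort_key set_sort distinct_sort)
  have "sorted_wrt (\<lambda>a b. d a \<le> d b \<and> a \<noteq> b) L"
    using L(2,3) by (induction L) auto
  then have "sorted_wrt (\<lambda>a b. a \<notin> ancestors b) L"
    by (rule sorted_wrt_mono_rel[rotated]) (use ancestor_rank in force)
  moreover have "a \<notin> ancestors b" if "a \<in> set M" "b \<in> set L" for a b
    using up_set_ancestor[OF up(1), of a b] that M(2) L(1) by auto
  ultimately have "sorted_wrt (\<lambda>a b. a \<notin> ancestors b) (M @ L)"
    using M by (simp add: sorted_wrt_append)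
  moreover have "distinct (M @ L)" using M L by auto
  moreover have set_ML: "set (M @ L) = W (Suc m) - W 0"
    using M L up base[of m] by auto
  moreover have "\<exists>xs ys. M @ L = xs @ ys \<and> set xs = W j - W 0" if j: "j \<le> Suc m" for j
  proof (cases "j = Suc m")
    case True
    then show ?thesis using set_ML by (metis append_Nil2)
  next
    case False
    with j have "j \<le> m" by simp
    then obtain xs ys where "M = xs @ ys" "set xs = W j - W 0" using M(4) by blast
    then show ?thesis by (intro exI[of _ xs] exI[of _ "ys @ L"]) auto
  qed
  ultimately show ?case by blast
qed


section \<open>Input resolution chains\<close>

text \<open>A linear tree whose side premises are the clauses of the literals in \<open>as\<close>.
  It grows at the end of the list, so initial segments of the list give subtrees; this is how one
  chain contains the clauses of all intermediate graphs.\<close>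

definition chain :: "'v lit \<Rightarrow> 'v lit list \<Rightarrow> 'v rtree" where
  "chain t as = foldl (\<lambda>T a. resolve_on a T (Leaf (insert a (neg ` P a))))
     (Leaf (insert t (neg ` P t))) as"

lemma chain_Nil [simp]: "chain t [] = Leaf (insert t (neg ` P t))"
  by (simp add: chain_def)

lemma chain_snoc [simp]:
  "chain t (as @ [a]) = resolve_on a (chain t as) (Leaf (insert a (neg ` P a)))"
  by (simp add: chain_def)

lemma num_nodes_chain: "num_nodes (chain t as) = 2 * length as + 1"
  by (induction as rule: rev_induct) (auto simp: num_nodes_def)

lemma res_vars_chain: "res_vars (chain t as) = var ` set as"
  by (induction as rule: rev_induct) auto

lemma chain_prefix: "chain t as \<in> set (postorder (chain t (as @ bs)))"
  by (induction bs rule: rev_induct) (auto simp flip: append_assoc)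

lemma regular_derivation_chain:
  assumes "set (t # as) \<subseteq> N" "distinct (map var as)"
  shows "regular_derivation F (chain t as)"
  using assms
proof (induction as rule: rev_induct)
  case Nil
  then show ?case by (auto simp: regular_derivation_def regular_tree_def clause_in_F)
next
  case (snoc a as)
  have "regular_derivation F (Leaf (insert a (neg ` P a)))"
    using snoc.prems by (auto simp: regular_derivation_def regular_tree_def clause_in_F)
  with snoc show ?case
    by (auto intro!: regular_derivation_resolve_on simp: res_vars_chain)
qed

text \<open>Conditions that make every step of the chain a genuine resolution. A successor of
  \<open>a\<close> in the list comes before \<open>a\<close> and has put \<open>neg a\<close> into
  the clause; for \<open>a = neg t\<close> this literal is \<open>t\<close> itself. By
  \<open>neg a \<notin> P a\<close>, the pivot \<open>a\<close> is not also the negation of a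
  predecessor of \<open>a\<close>.\<close>

definition derivation_order :: "'v lit \<Rightarrow> 'v lit list \<Rightarrow> bool" where
  "derivation_order t as \<longleftrightarrow>
     set (t # as) \<subseteq> N \<and> distinct (t # as) \<and> sorted_wrt (\<lambda>a b. a \<notin> P b) (t # as) \<and>
     (\<forall>a\<in>set as. neg a \<notin> P a \<and> (a = neg t \<or> (\<exists>b\<in>set (t # as). a \<in> P b)))"

lemma derivation_order_snoc:
  assumes "derivation_order t (as @ [a])"
  shows "derivation_order t as" "neg a \<notin> P a" "a = neg t \<or> a \<in> \<Union> (P ` set (t # as))"
    "P a \<inter> set (t # as) = {}" "a \<notin> set (t # as)" "a \<in> N"
proof -
  have a: "a \<in> N" "a \<notin> P a"
    using assms not_self_pred by (auto simp: derivation_order_def)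
  have before: "c \<notin> P a" if "c \<in> set (t # as)" for c
    using assms that by (auto simp: derivation_order_def sorted_wrt_append)
  show "derivation_order t as"
    using assms before unfolding derivation_order_def by (auto simp: sorted_wrt_append)
  show "neg a \<notin> P a" "a = neg t \<or> a \<in> \<Union> (P ` set (t # as))"
    "P a \<inter> set (t # as) = {}" "a \<notin> set (t # as)" "a \<in> N"
    using assms before a unfolding derivation_order_def by auto
qed

text \<open>Pretending that both \<open>t\<close> and \<open>neg t\<close> have an outgoing arc lets the same formula describe
  conflict clauses, where \<open>t\<close> is a predecessor of \<open>Box\<close>, and clauses induced by \<open>t\<close>.\<close>

lemma chain_input:
  assumes "derivation_order t as"
  shows "input_tree (chain t as) \<and>
    root_clause (chain t as) = neg ` ({t, neg t} \<union> \<Union> (P ` set (t # as)) - set (t # as))"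
  using assms
proof (induction as rule: rev_induct)
  case Nil
  then have "t \<notin> P t" using not_self_pred by (auto simp: derivation_order_def)
  then show ?case by auto
next
  case (snoc a as)
  note s = derivation_order_snoc[OF snoc.prems]
  have IH: "input_tree (chain t as)"
    "root_clause (chain t as) = neg ` ({t, neg t} \<union> \<Union> (P ` set (t # as)) - set (t # as))"
    using snoc.IH s(1) by auto
  have "neg a \<in> root_clause (chain t as)"
    unfolding IH(2) mem_neg_image_iff neg_neg using s(3,5) by blast
  then have "input_tree (chain t (as @ [a]))"
    using input_tree_resolve_on[OF IH(1)] by simp
  moreover have "root_clause (chain t (as @ [a])) =
      neg ` ({t, neg t} \<union> \<Union> (P ` set (t # as @ [a])) - set (t # as @ [a]))" (is "?L = ?R")
  proof (rule set_eqI)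
    fix c
    \<comment> \<open>By \<open>s(2)\<close>, deleting the pivot from the clause of \<open>a\<close>
      loses no negated predecessor. By \<open>s(4)\<close>, none of these predecessors has been
      resolved on before.\<close>
    have "c \<in> ?L \<longleftrightarrow> (neg c \<in> {t, neg t} \<union> \<Union> (P ` set (t # as)) - set (t # as) \<and> neg c \<noteq> a) \<or>
        (neg c \<in> P a)"
      using IH(2) s(2) by (auto simp: neg_eq_iff[of _ "neg a", symmetric] simp del: neg_eq_iff)
    also have "\<dots> \<longleftrightarrow> neg c \<in> {t, neg t} \<union> \<Union> (P ` set (t # as @ [a])) - set (t # as @ [a])"
      using s(4) not_self_pred[OF s(6)] by auto
    finally show "c \<in> ?L \<longleftrightarrow> c \<in> ?R" by simp
  qed
  ultimately show ?case by blast
qed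

text \<open>An implied successor of the head \<open>t\<close> would be a later element with ancestor
  \<open>t\<close>. So \<open>t\<close> is a literal of \<open>x\<close>, the set
  \<open>{t, neg t}\<close> consists of the predecessors of \<open>Box\<close>, and the formula of
  \<open>chain_input\<close> becomes the boundary. The literal \<open>neg t\<close> may still occur
  as a later pivot.\<close>

lemma conflict_chain:
  assumes U: "up_set U" and M: "distinct (t # as)" "set (t # as) = U"
    and sorted: "sorted_wrt (\<lambda>a b. a \<notin> ancestors b) (t # as)"
  shows "var t = x" "input_tree (chain t as)" "root_clause (chain t as) = neg ` boundary U"
proof -
  have UN: "U \<subseteq> N" using U by (simp add: up_set_def)
  have "t \<notin> P b" if "b \<in> N" for b
  proof
    assume "t \<in> P b"
    then have "b \<in> U" "t \<in> ancestors b" "t \<noteq> b"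
      using that U M(2) pred_ancestor not_self_pred[OF that] by (auto simp: up_set_def)
    then show False using sorted M(2) by auto
  qed
  then have t: "t \<in> {Pos x, Neg x}" using N_subset UN M(2) by auto
  then show "var t = x" by auto
  have conflict: "{Pos x, Neg x} = {t, neg t}" using t by auto
  have "derivation_order t as"
    unfolding derivation_order_def
  proof (intro conjI ballI)
    show "set (t # as) \<subseteq> N" "distinct (t # as)" using UN M by auto
    show "sorted_wrt (\<lambda>a b. a \<notin> P b) (t # as)"
      by (rule sorted_wrt_mono_rel[OF _ sorted]) (use UN M(2) pred_ancestor in auto)
    fix a assume a: "a \<in> set as"
    then have aU: "a \<in> U" "a \<in> N" "a \<noteq> t" "t \<notin> ancestors a" using M UN sorted by auto
    show "neg a \<notin> P a"
    proof
      assume na: "neg a \<in> P a"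
      then have "var a = x" using neg_not_pred aU by blast
      then have "neg a = t" using aU(3) \<open>var t = x\<close> by (metis neg_neg var_eq_iff)
      then show False using na aU pred_ancestor by fastforce
    qed
    show "a = neg t \<or> (\<exists>b\<in>set (t # as). a \<in> P b)"
    proof (cases "a \<in> {Pos x, Neg x}")
      case True
      then show ?thesis using conflict aU(3) by auto
    next
      case False
      then obtain b where "b \<in> N" "a \<in> P b" using N_subset aU(2) by blast
      then show ?thesis using U aU(1) M(2) by (auto simp: up_set_def)
    qed
  qed
  from chain_input[OF this] show "input_tree (chain t as)"
    "root_clause (chain t as) = neg ` boundary U"
    unfolding boundary_def M(2) conflict by auto
qed

text \<open>With sinks first, no ancestor of \<open>v\<close> precedes \<open>v\<close>, and none
  lies in \<open>U\<close>, as \<open>v\<close> would follow. So the filter collects all proper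
  ancestors of \<open>v\<close> in \<open>U'\<close>.\<close>

lemma induced_chain:
  assumes U: "up_set U" "up_set U'" "U \<subseteq> U'" "U \<noteq> {}"
    and M: "distinct (zs @ v # ws)" "set (zs @ v # ws) = U' - U"
    and sorted: "sorted_wrt (\<lambda>a b. a \<notin> ancestors b) (zs @ v # ws)"
  shows "input_tree (chain v (filter (\<lambda>a. a \<in> ancestors v) ws))"
    "root_clause (chain v (filter (\<lambda>a. a \<in> ancestors v) ws)) = induced U' v"
proof -
  let ?as = "filter (\<lambda>a. a \<in> ancestors v) ws"
  have UN: "U' \<subseteq> N" using U by (simp add: up_set_def)
  have v: "v \<in> N" "v \<notin> U" "v \<in> U'" using M(2) UN by auto
  have not_U: "a \<notin> U" if "a \<in> ancestors v" for a
    using that U(1) v(2) up_set_ancestor by blast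
  have set_as: "set (v # ?as) = ancestors v \<inter> U'"
  proof
    show "set (v # ?as) \<subseteq> ancestors v \<inter> U'" using M(2) by auto
    show "ancestors v \<inter> U' \<subseteq> set (v # ?as)"
    proof
      fix a assume a: "a \<in> ancestors v \<inter> U'"
      then have "a \<in> set (zs @ v # ws)" using M(2) not_U by blast
      moreover have "a \<notin> set zs" using a sorted by (auto simp: sorted_wrt_append)
      ultimately show "a \<in> set (v # ?as)" using a by auto
    qed
  qed
  \<comment> \<open>Hence \<open>neg v\<close> is never a pivot: in the formula of
    \<open>chain_input\<close>, its pretended arc contributes the literal \<open>v\<close> of the
    induced clause.\<close>
  have neg_v: "neg v \<notin> ancestors v" using neg_not_ancestor U v by blast
  have sub: "\<Union> (P ` (ancestors v \<inter> U')) \<subseteq> ancestors v"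
    using UN pred_ancestor by blast
  have "derivation_order v ?as"
    unfolding derivation_order_def
  proof (intro conjI ballI)
    show "set (v # ?as) \<subseteq> N" using set_as UN by auto
    show "distinct (v # ?as)" using M(1) by auto
    have "sorted_wrt (\<lambda>a b. a \<notin> ancestors b) (v # ?as)"
      using sorted by (auto simp: sorted_wrt_append sorted_wrt_filter)
    then show "sorted_wrt (\<lambda>a b. a \<notin> P b) (v # ?as)"
      by (rule sorted_wrt_mono_rel[rotated]) (use UN set_as pred_ancestor in auto)
    fix a assume a: "a \<in> set ?as"
    then have a': "a \<in> ancestors v" "a \<in> U'" "a \<noteq> v" "a \<in> N" "a \<notin> U"
      using set_as M(1) UN not_U by auto
    show "neg a \<notin> P a"
      using neg_not_ancestor[OF U(1,4) a'(4,5)] pred_ancestor[OF a'(4)] by fastforce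
    from a'(1) show "a = neg v \<or> (\<exists>b\<in>set (v # ?as). a \<in> P b)"
    proof (cases rule: ancestor_cases)
      case 1
      then show ?thesis using a' by simp
    next
      case (2 b)
      then have "b \<in> U'" using U(2) a'(2) by (auto simp: up_set_def)
      then show ?thesis using set_as 2 by blast
    qed
  qed
  from chain_input[OF this] show "input_tree (chain v ?as)"
    "root_clause (chain v ?as) = induced U' v"
    unfolding set_as induced_def using neg_v v(3) sub by auto
qed


section \<open>Extending a derivation by one parallel step\<close>

text \<open>The head of the list is resolved on at the root, so a list with sinks first is processed
  sources first. \<open>B\<close> will be the boundary of the smaller up-set. The chain for
  \<open>v\<close> uses only literals listed after \<open>v\<close>.\<close>

primrec spine :: "'v rtree \<Rightarrow> 'v lit set \<Rightarrow> 'v lit list \<Rightarrow> 'v rtree" where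
  "spine T B [] = T"
| "spine T B (v # ws) =
     (if v \<in> B then resolve_on v (spine T B ws) (chain v (filter (\<lambda>a. a \<in> ancestors v) ws))
      else spine T B ws)"

lemma postorder_spine_append: "set (postorder (spine T B ws)) \<subseteq> set (postorder (spine T B (vs @ ws)))"
  by (induction vs) auto

lemma postorder_spine: "set (postorder T) \<subseteq> set (postorder (spine T B ws))"
  using postorder_spine_append[of T B "[]" ws] by simp

lemma chain_in_spine:
  assumes "v \<in> B"
  shows "chain v (filter (\<lambda>a. a \<in> ancestors v) ws) \<in> set (postorder (spine T B (zs @ v # ws)))"
  using assms postorder_spine_append[of T B "v # ws" zs] by auto

lemma res_vars_spine: "res_vars (spine T B ws) \<subseteq> res_vars T \<union> var ` set ws"
  by (induction ws) (auto simp: res_vars_chain)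

text \<open>A literal with \<open>r\<close> literals after it adds at most a chain of
  \<open>2 * r + 1\<close> nodes and one inference; the even numbers \<open>2 * (r + 1)\<close> sum
  to the bound.\<close>

lemma num_nodes_spine:
  "num_nodes (spine T B ws) \<le> num_nodes T + length ws * (length ws + 1)"
proof (induction ws)
  case (Cons v ws)
  have "length (filter (\<lambda>a. a \<in> ancestors v) ws) \<le> length ws" by simp
  with Cons show ?case by (auto simp add: num_nodes_chain algebra_simps simp del: length_filter_le)
qed simp

text \<open>Below the inference on \<open>v\<close>, only variables of \<open>T\<close> and of
  literals listed after \<open>v\<close> are resolved on.\<close>

lemma regular_derivation_spine:
  assumes "regular_derivation F T" "distinct (map var ws)" "set ws \<subseteq> N"
    and "res_vars T \<inter> var ` set ws = {}"
  shows "regular_derivation F (spine T B ws)"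
  using assms
proof (induction ws)
  case (Cons v ws)
  have "regular_derivation F (chain v (filter (\<lambda>a. a \<in> ancestors v) ws))"
    using Cons.prems by (intro regular_derivation_chain) (auto simp: distinct_map_filter)
  with Cons res_vars_spine[of T B ws] show ?case
    by (auto intro!: regular_derivation_resolve_on simp: res_vars_chain)
qed simp

lemma root_clause_spine:
  assumes U: "up_set U" "up_set U'" "U \<subseteq> U'" "U \<noteq> {}"
    and M: "distinct M" "set M = U' - U" "sorted_wrt (\<lambda>a b. a \<notin> ancestors b) M"
    and T: "root_clause T = neg ` boundary U"
  shows "root_clause (spine T (boundary U) M) = neg ` boundary U'"
proof -
  let ?A = "\<lambda>v. \<Union> (P ` (ancestors v \<inter> U')) - U'"
  have UN: "U' \<subseteq> N" using U by (simp add: up_set_def)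
  \<comment> \<open>Invariant: each boundary literal in the processed suffix has been replaced by
    the leaves for \<open>U'\<close> that have an arc into one of its ancestors in
    \<open>U'\<close>.\<close>
  have *: "root_clause (spine T (boundary U) ws) =
      neg ` ((boundary U - set ws) \<union> \<Union> (?A ` (boundary U \<inter> set ws)))"
    if "M = zs @ ws" for zs ws
    using that
  proof (induction ws arbitrary: zs)
    case Nil
    then show ?case using T by simp
  next
    case (Cons v ws)
    have IH: "root_clause (spine T (boundary U) ws) =
        neg ` ((boundary U - set ws) \<union> \<Union> (?A ` (boundary U \<inter> set ws)))"
      using Cons by (metis append.assoc append_Cons append_Nil)
    show ?case
    proof (cases "v \<in> boundary U")
      case True
      have v: "v \<in> U'" "v \<notin> U" "v \<notin> set ws" using M Cons.prems by auto
      have "neg v \<notin> ancestors v" using neg_not_ancestor U v UN by blast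
      then have nv: "neg v \<notin> ?A v" using UN pred_ancestor by blast
      have root: "root_clause (chain v (filter (\<lambda>a. a \<in> ancestors v) ws)) = insert v (neg ` ?A v)"
        using induced_chain(2)[OF U] M Cons.prems by (simp add: induced_def)
      have "insert v (neg ` ?A v) - {v} = neg ` ?A v" using nv by auto
      \<comment> \<open>As \<open>v\<close> lies in \<open>U'\<close>, it is in no set
        \<open>?A\<close>; removing its negation affects only the boundary part.\<close>
      moreover have "neg ` ((boundary U - set ws) \<union> \<Union> (?A ` (boundary U \<inter> set ws))) - {neg v} =
          neg ` ((boundary U - set (v # ws)) \<union> \<Union> (?A ` (boundary U \<inter> set ws)))"
        using v by (auto simp: neg_eq_iff[of _ "neg v", symmetric] simp del: neg_eq_iff)
      moreover have "boundary U \<inter> set (v # ws) = insert v (boundary U \<inter> set ws)"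
        using True by auto
      ultimately show ?thesis
        using True by (simp add: IH root image_Un Un_ac del: Un_iff)
    next
      case False
      then show ?thesis using IH by auto
    qed
  qed
  \<comment> \<open>Outside the boundary, a literal of \<open>U' - U\<close> has a successor in
    \<open>U' - U\<close> of smaller rank. So each new implied literal is covered by a resolved
    leaf, and no leaf for \<open>U'\<close> is missed.\<close>
  have exit: "\<exists>l\<in>boundary U \<inter> (U' - U). v \<in> ancestors l" if "v \<in> U' - U" for v
    using that
  proof (induction "d v" arbitrary: v rule: less_induct)
    case less
    show ?case
    proof (cases "v \<in> boundary U")
      case True
      then show ?thesis using less.prems by (intro bexI[of _ v]) auto
    next
      case False
      then obtain b where b: "b \<in> N" "v \<in> P b" "b \<notin> U"
        using less.prems UN N_subset unfolding boundary_def by blast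
      then have "b \<in> U'" using U(2) less.prems by (auto simp: up_set_def)
      then show ?thesis using less.hyps[of b] b rank_less pred_ancestor by blast
    qed
  qed
  have "(boundary U - (U' - U)) \<union> \<Union> (?A ` (boundary U \<inter> (U' - U))) = boundary U'"
  proof
    show "(boundary U - (U' - U)) \<union> \<Union> (?A ` (boundary U \<inter> (U' - U))) \<subseteq> boundary U'"
      using U(3) by (auto simp: boundary_def)
    show "boundary U' \<subseteq> (boundary U - (U' - U)) \<union> \<Union> (?A ` (boundary U \<inter> (U' - U)))"
    proof
      fix a assume a: "a \<in> boundary U'"
      show "a \<in> (boundary U - (U' - U)) \<union> \<Union> (?A ` (boundary U \<inter> (U' - U)))"
      proof (cases "a \<in> boundary U")
        case True
        then show ?thesis using a by (auto simp: boundary_def)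
      next
        case False
        then obtain b where b: "b \<in> U' - U" "a \<in> P b" "a \<notin> U'"
          using a U(3) unfolding boundary_def by blast
        then show ?thesis using exit[OF b(1)] by blast
      qed
    qed
  qed
  then show ?thesis using *[of "[]" M] M(2) by simp
qed

text \<open>Only \<open>x\<close> can have both of its literals in \<open>N\<close>, and one of them
  is \<open>t\<close>.\<close>

lemma inj_on_var:
  assumes "var t = x"
  shows "inj_on var (N - {t})"
proof (rule inj_onI)
  fix a b assume ab: "a \<in> N - {t}" "b \<in> N - {t}" "var a = var b"
  show "a = b"
  proof (rule ccontr)
    assume "a \<noteq> b"
    then have "a = neg b" using ab(3) var_eq_iff by blast
    moreover have "a \<in> N" "b \<in> N" using ab by auto
    ultimately have "var b = x" using N_subset unique_conflict[of b] by blast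
    then have "b = neg t" using ab assms var_eq_iff by (metis DiffE singletonI)
    with \<open>a = neg b\<close> ab(1) show False by simp
  qed
qed

text \<open>Since \<open>t\<close> stays in \<open>W 0\<close>, it is never a pivot. The new pivots
  then have distinct variables, none of which is resolved on in \<open>T\<close>.\<close>

lemma parallel_step:
  assumes W: "\<And>j. j \<le> m \<Longrightarrow> up_set (W j)" "\<And>j. j < m \<Longrightarrow> W j \<subseteq> W (Suc j)"
    and t: "t \<in> W 0" "var t = x"
    and T: "regular_derivation F T" "root_clause T = neg ` boundary (W 0)"
      "res_vars T \<subseteq> var ` (W 0 - {t})" "num_nodes T \<le> (card (W 0) + 1)\<^sup>2"
  shows "\<exists>T'. regular_derivation F T' \<and> root_clause T' = neg ` boundary (W m) \<and>
    res_vars T' \<subseteq> var ` (W m - {t}) \<and> num_nodes T' \<le> (card (W m) + 1)\<^sup>2 \<and>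
    set (postorder T) \<subseteq> set (postorder T') \<and>
    (\<forall>j\<le>m. \<forall>l\<in>boundary (W 0) \<inter> W j. induced (W j) l \<in> input_derived_clauses T')"
proof -
  obtain M where M: "distinct M" "set M = W m - W 0" "sorted_wrt (\<lambda>a b. a \<notin> ancestors b) M"
    and prefix: "\<forall>j\<le>m. \<exists>xs ys. M = xs @ ys \<and> set xs = W j - W 0"
    using topological_list[where W = W and m = m, OF W] by blast
  have sub: "W 0 \<subseteq> W j" if "j \<le> m" for j
    using that
  proof (induction j)
    case (Suc j)
    then show ?case using W(2)[of j] by auto
  qed simp
  have N: "W m \<subseteq> N" "W 0 \<subseteq> N" "W 0 \<subseteq> W m" using W(1) sub by (auto simp: up_set_def)
  have ne: "W 0 \<noteq> {}" using t by auto
  let ?T = "spine T (boundary (W 0)) M"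
  have disjoint: "var ` (W 0 - {t}) \<inter> var ` set M = {}"
    using inj_on_image_Int[OF inj_on_var[OF t(2)], of "W 0 - {t}" "set M"] M(2) N t(1) by auto
  have "distinct (map var M)"
    using M inj_on_subset[OF inj_on_var[OF t(2)], of "set M"] N t(1) by (auto simp: distinct_map)
  then have "regular_derivation F ?T"
    using T disjoint M(2) N by (intro regular_derivation_spine) auto
  moreover have "root_clause ?T = neg ` boundary (W m)"
    using root_clause_spine[OF _ _ _ _ M(1,2,3) T(2)] W(1) N ne by auto
  moreover have "res_vars ?T \<subseteq> var ` (W m - {t})"
    using res_vars_spine[of T "boundary (W 0)" M] T(3) M(2) N t by blast
  \<comment> \<open>With \<open>c\<close> old and \<open>d\<close> new literals,
    \<open>(c + 1)^2 + d * (d + 1) \<le> (c + d + 1)^2\<close>.\<close>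
  moreover have "num_nodes ?T \<le> (card (W m) + 1)\<^sup>2"
  proof -
    have "card (W m) = card (W 0) + length M"
      using M N finite_N by (metis card_Diff_subset card_mono distinct_card finite_subset
          le_add_diff_inverse)
    then show ?thesis
      using num_nodes_spine[of T "boundary (W 0)" M] T(4) by (simp add: power2_eq_square algebra_simps)
  qed
  moreover have "induced (W j) l \<in> input_derived_clauses ?T"
    if j: "j \<le> m" and l: "l \<in> boundary (W 0) \<inter> W j" for j l
  proof -
    obtain xs ys where xs: "M = xs @ ys" "set xs = W j - W 0" using prefix j by blast
    have "l \<in> set xs" using l xs(2) by (auto simp: boundary_def)
    then obtain zs ws where zs: "xs = zs @ l # ws" by (meson split_list)
    let ?C = "chain l (filter (\<lambda>a. a \<in> ancestors l) ws)"
    have "sorted_wrt (\<lambda>a b. a \<notin> ancestors b) xs" "distinct xs"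
      using M xs(1) by (auto simp: sorted_wrt_append)
    then have C: "input_tree ?C" "root_clause ?C = induced (W j) l"
      using induced_chain[of "W 0" "W j" zs l ws] W(1) sub[OF j] ne j xs(2) zs by auto
    \<comment> \<open>Filtering distributes over append, so the chain for \<open>W j\<close> is an
      initial part of the chain used in the tree.\<close>
    have "?C \<in> set (postorder (chain l (filter (\<lambda>a. a \<in> ancestors l) (ws @ ys))))"
      by (simp add: chain_prefix)
    moreover have "set (postorder S) \<subseteq> set (postorder S')" if "S \<in> set (postorder S')"
      for S S' :: "'v rtree"
      using that by (induction S') auto
    ultimately have "?C \<in> set (postorder ?T)"
      using chain_in_spine[of l "boundary (W 0)" "ws @ ys" T zs] l xs(1) zs by force
    then show ?thesis using C unfolding input_derived_clauses_def by force
  qed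
  ultimately show ?thesis
    using postorder_spine[of T "boundary (W 0)" M] by (intro exI[of _ ?T] conjI allI impI ballI)
qed

text \<open>A single chain over \<open>W m\<close> suffices: every \<open>W j\<close> is listed in a
  prefix, and all these prefixes start with the same \<open>t\<close>.\<close>

lemma series_start:
  assumes W: "\<And>j. 1 \<le> j \<Longrightarrow> j \<le> m \<Longrightarrow> up_set (W j)" "\<And>j. 1 \<le> j \<Longrightarrow> j < m \<Longrightarrow> W j \<subseteq> W (Suc j)"
    and ne: "W 1 \<noteq> {}" "1 \<le> m"
  shows "\<exists>t T. t \<in> W m \<and> var t = x \<and> regular_derivation F T \<and>
    root_clause T = neg ` boundary (W m) \<and> res_vars T \<subseteq> var ` (W m - {t}) \<and>
    num_nodes T \<le> (card (W m) + 1)\<^sup>2 \<and>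
    (\<forall>j. 1 \<le> j \<longrightarrow> j \<le> m \<longrightarrow> neg ` boundary (W j) \<in> input_derived_clauses T)"
proof -
  \<comment> \<open>Starting from the empty up-set makes the list exhaust \<open>W m\<close>. The
    smallest graph may itself have an implied literal, if there is an arc between the two literals
    of \<open>x\<close>.\<close>
  define W' where "W' j = (if j = 0 then {} else W j)" for j
  have *: "\<exists>M. distinct M \<and> set M = W' m - W' 0 \<and> sorted_wrt (\<lambda>a b. a \<notin> ancestors b) M \<and>
             (\<forall>j\<le>m. \<exists>xs ys. M = xs @ ys \<and> set xs = W' j - W' 0)"
    by (rule topological_list) (use W in \<open>auto simp: W'_def up_set_def\<close>)
  obtain M where M: "distinct M" "set M = W m" "sorted_wrt (\<lambda>a b. a \<notin> ancestors b) M"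
    and prefix: "\<And>j. 1 \<le> j \<Longrightarrow> j \<le> m \<Longrightarrow> \<exists>xs ys. M = xs @ ys \<and> set xs = W j"
  proof -
    have "W' 0 = {}" "\<And>j. 1 \<le> j \<Longrightarrow> W' j = W j" by (auto simp: W'_def)
    with * ne(2) that show thesis by (metis Diff_empty)
  qed
  have mono: "W 1 \<subseteq> W j" if "1 \<le> j" "j \<le> m" for j
    using that
  proof (induction j)
    case (Suc j)
    then show ?case using W(2)[of j] by (cases "j = 0") auto
  qed simp
  have "M \<noteq> []" using M(2) mono[of m] ne by auto
  then obtain t as where ta: "M = t # as" by (cases M) auto
  have up: "up_set (W m)" using W ne by auto
  have top: "var t = x" "root_clause (chain t as) = neg ` boundary (W m)"
    using conflict_chain[OF up] M ta by auto
  have N: "W m \<subseteq> N" using up by (simp add: up_set_def)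
  have set_as: "set as = W m - {t}" using M ta by auto
  have "distinct (map var as)"
    using M ta inj_on_subset[OF inj_on_var[OF top(1)], of "set as"] N set_as by (auto simp: distinct_map)
  then have "regular_derivation F (chain t as)"
    using M N ta by (intro regular_derivation_chain) auto
  moreover have "num_nodes (chain t as) \<le> (card (W m) + 1)\<^sup>2"
  proof -
    have "card (W m) = length as + 1" using M ta distinct_card by fastforce
    then show ?thesis by (simp add: num_nodes_chain power2_eq_square)
  qed
  moreover have "neg ` boundary (W j) \<in> input_derived_clauses (chain t as)" if j: "1 \<le> j" "j \<le> m" for j
  proof -
    obtain xs ys where xs: "M = xs @ ys" "set xs = W j" using prefix j by blast
    then have "xs \<noteq> []" using mono[OF j] ne by auto
    then obtain bs where bs: "xs = t # bs" "as = bs @ ys" using xs(1) ta by (cases xs) auto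
    have "sorted_wrt (\<lambda>a b. a \<notin> ancestors b) xs" "distinct xs"
      using M xs(1) by (auto simp: sorted_wrt_append)
    then have "input_tree (chain t bs)" "root_clause (chain t bs) = neg ` boundary (W j)"
      using conflict_chain[of "W j" t bs] W(1)[OF j] xs(2) bs(1) by auto
    moreover have "chain t bs \<in> set (postorder (chain t as))" using chain_prefix bs by simp
    ultimately show ?thesis unfolding input_derived_clauses_def by force
  qed
  ultimately show ?thesis using top set_as M(2) ta res_vars_chain
    by (intro exI[of _ t] exI[of _ "chain t as"]) auto
qed

end

section \<open>Subconflict graphs as up-sets\<close>

definition implied :: "'v graph \<Rightarrow> 'v lit set" where
  "implied K = {l. Lit l \<in> pverts K \<and> in_degree K (Lit l) \<noteq> 0}"

definition preds :: "'v graph \<Rightarrow> 'v lit \<Rightarrow> 'v lit set" where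
  "preds K l = {l'. (Lit l', Lit l) \<in> parcs K}"

lemma in_degree_eq_0_iff:
  assumes "pair_fin_digraph K"
  shows "in_degree K v = 0 \<longleftrightarrow> (\<forall>u. (u, v) \<notin> parcs K)"
proof -
  \<comment> \<open>Degrees are cardinalities, so an infinite set of arcs would also have degree
    0.\<close>
  have "finite (in_arcs K v)"
    using pair_fin_digraph.pair_finite_arcs[OF assms] by (simp add: in_arcs_def)
  then show ?thesis by (auto simp: in_degree_def in_arcs_def)
qed

lemma out_degree_eq_0_iff:
  assumes "pair_fin_digraph K"
  shows "out_degree K v = 0 \<longleftrightarrow> (\<forall>w. (v, w) \<notin> parcs K)"
proof -
  have "finite (out_arcs K v)"
    using pair_fin_digraph.pair_finite_arcs[OF assms] by (simp add: out_arcs_def)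
  then show ?thesis by (auto simp: out_degree_def out_arcs_def)
qed

lemma arc_in_pverts:
  assumes "pair_fin_digraph K" "(u, v) \<in> parcs K"
  shows "u \<in> pverts K" "v \<in> pverts K"
  using assms pair_wf_digraph.wellformed' pair_fin_digraph.axioms(1) by metis+

lemma implied_iff: "pair_fin_digraph K \<Longrightarrow> l \<in> implied K \<longleftrightarrow> (\<exists>u. (u, Lit l) \<in> parcs K)"
  using arc_in_pverts by (fastforce simp: implied_def in_degree_eq_0_iff)

lemma implied_in_pverts: "l \<in> implied K \<Longrightarrow> Lit l \<in> pverts K"
  by (simp add: implied_def)

lemma leaves_eq:
  fixes K :: "'v graph"
  shows "leaves K = {l. Lit l \<in> pverts K} - implied K"
  by (auto simp: leaves_def implied_def)

lemma CC_eq: "CC K = neg ` leaves K"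
  by (auto simp: CC_def)

lemma conflict_graph_wrt_fin: "conflict_graph_wrt F Q K \<Longrightarrow> pair_fin_digraph K"
  by (simp add: conflict_graph_wrt_def)

lemma Box_no_out_arc:
  assumes "conflict_graph_wrt F Q K"
  shows "(Box, v) \<notin> parcs K"
proof -
  have "{v \<in> pverts K. out_degree K v = 0} = {Box}"
    using assms by (simp add: conflict_graph_wrt_def)
  then have "out_degree K Box = 0" by blast
  then show ?thesis using out_degree_eq_0_iff[OF conflict_graph_wrt_fin[OF assms]] by simp
qed

lemma out_arc_exists:
  assumes "conflict_graph_wrt F Q K" "Lit l \<in> pverts K"
  shows "\<exists>w. (Lit l, w) \<in> parcs K"
proof (rule ccontr)
  assume "\<nexists>w. (Lit l, w) \<in> parcs K"
  then have "out_degree K (Lit l) = 0"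
    using out_degree_eq_0_iff[OF conflict_graph_wrt_fin[OF assms(1)]] by simp
  moreover have "{v \<in> pverts K. out_degree K v = 0} = {Box}"
    using assms(1) by (simp add: conflict_graph_wrt_def)
  ultimately show False using assms(2) by (auto simp: set_eq_iff)
qed

text \<open>Only \<open>Box\<close> lacks outgoing arcs, so every literal node has an arc to
  \<open>Box\<close> or to an implied literal.\<close>

lemma Lit_in_pverts_iff:
  assumes K: "conflict_graph_wrt F Q K"
    and Box: "{u. (u, Box) \<in> parcs K} = {Lit (Pos x), Lit (Neg x)}"
  shows "Lit l \<in> pverts K \<longleftrightarrow> l \<in> {Pos x, Neg x} \<union> \<Union> (preds K ` implied K)"
proof
  assume "Lit l \<in> pverts K"
  then obtain w where w: "(Lit l, w) \<in> parcs K" using out_arc_exists K by blast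
  show "l \<in> {Pos x, Neg x} \<union> \<Union> (preds K ` implied K)"
  proof (cases w)
    case Box
    then show ?thesis using w assms(2) by auto
  next
    case (Lit a)
    then show ?thesis using w implied_iff conflict_graph_wrt_fin[OF K] by (auto simp: preds_def)
  qed
next
  assume "l \<in> {Pos x, Neg x} \<union> \<Union> (preds K ` implied K)"
  then obtain w where "(Lit l, w) \<in> parcs K" using Box by (auto simp: preds_def)
  then show "Lit l \<in> pverts K" by (rule arc_in_pverts(1)[OF conflict_graph_wrt_fin[OF K]])
qed

section \<open>The implication dag of a conflict graph\<close>

locale conflict_graph_locale =
  fixes F :: "'v clause set" and Q :: "'v lit \<Rightarrow> bool" and G :: "'v graph" and x :: 'v
  assumes G: "conflict_graph_wrt F Q G"
    and Box_preds: "{u. (u, Box) \<in> parcs G} = {Lit (Pos x), Lit (Neg x)}"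
begin

lemma fin_G: "pair_fin_digraph G"
  using G by (rule conflict_graph_wrt_fin)

lemma conflict_variable:
  assumes "Lit a \<in> pverts G" "Lit (neg a) \<in> pverts G"
  shows "var a = x"
proof -
  have ex1: "\<exists>!y. Lit (Pos y) \<in> pverts G \<and> Lit (Neg y) \<in> pverts G"
    using G unfolding conflict_graph_wrt_def by blast
  have "Lit (Pos x) \<in> pverts G" "Lit (Neg x) \<in> pverts G"
    using Box_preds arc_in_pverts[OF fin_G] by blast+
  moreover have "Lit (Pos (var a)) \<in> pverts G" "Lit (Neg (var a)) \<in> pverts G"
    using assms by (cases a; simp)+
  ultimately show ?thesis using ex1 by blast
qed

sublocale implication_dag F "implied G" "preds G" x "\<lambda>l. card {w. (Lit l, w) \<in> (parcs G)\<^sup>+}"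
proof
  have fin: "finite (pverts G)" "finite (parcs G)"
    using fin_G pair_fin_digraph.pair_finite_verts pair_fin_digraph.pair_finite_arcs by blast+
  have "Lit ` implied G \<subseteq> pverts G" using implied_in_pverts by blast
  then show "finite (implied G)"
    using fin finite_subset finite_imageD by (metis inj_onI node.inject)
  show "implied G \<subseteq> {Pos x, Neg x} \<union> \<Union> (preds G ` implied G)"
    using Lit_in_pverts_iff[OF G Box_preds] implied_in_pverts by blast
  show "insert a (neg ` preds G a) \<in> F" if "a \<in> implied G" for a
  proof -
    have "\<forall>l. Lit l \<in> pverts G \<longrightarrow> in_degree G (Lit l) = 0 \<and> Q l \<or>
        (\<exists>C\<in>F. C = {l} \<union> {l'. (Lit (neg l'), Lit l) \<in> parcs G})"
      using G unfolding conflict_graph_wrt_def by (elim conjE)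
    moreover have "Lit a \<in> pverts G" "in_degree G (Lit a) \<noteq> 0"
      using that by (simp_all add: implied_def)
    ultimately have "{a} \<union> {l'. (Lit (neg l'), Lit a) \<in> parcs G} \<in> F" by metis
    moreover have "{l'. (Lit (neg l'), Lit a) \<in> parcs G} = neg ` preds G a"
      by (auto simp: preds_def)
    ultimately show ?thesis by simp
  qed
  \<comment> \<open>The rank counts the nodes reachable by nonempty paths. Along an arc from
    \<open>a\<close> to \<open>b\<close> the set shrinks and, by acyclicity, loses
    \<open>Lit b\<close>.\<close>
  show "card {w. (Lit b, w) \<in> (parcs G)\<^sup>+} < card {w. (Lit a, w) \<in> (parcs G)\<^sup>+}"
    if "a \<in> preds G b" for a b
  proof (rule psubset_card_mono)
    have "{w. (Lit a, w) \<in> (parcs G)\<^sup>+} \<subseteq> Range (parcs G)"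
      by (subst trancl_range[symmetric]) (rule subsetI, rule RangeI, erule CollectD)
    then show "finite {w. (Lit a, w) \<in> (parcs G)\<^sup>+}"
      using fin(2) finite_Range finite_subset by blast
    have arc: "(Lit a, Lit b) \<in> parcs G" using that by (simp add: preds_def)
    moreover have "(Lit b, Lit b) \<notin> (parcs G)\<^sup>+"
      using G by (simp add: conflict_graph_wrt_def acyclic_def)
    ultimately show "{w. (Lit b, w) \<in> (parcs G)\<^sup>+} \<subset> {w. (Lit a, w) \<in> (parcs G)\<^sup>+}"
      by (auto intro: trancl_into_trancl2)
  qed
  show "var a = x"
    if "a \<in> {Pos x, Neg x} \<union> \<Union> (preds G ` implied G)"
      "neg a \<in> {Pos x, Neg x} \<union> \<Union> (preds G ` implied G)" for a
    using that conflict_variable Lit_in_pverts_iff[OF G Box_preds] by blast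
qed

section \<open>Proper subconflict graphs of a fixed conflict graph\<close>

context
  fixes K :: "'v graph"
  assumes proper: "proper_subconflict_graph F K G"
begin

lemma subconflict: "conflict_graph_wrt F (\<lambda>_. True) K" "pverts K \<subseteq> pverts G" "parcs K \<subseteq> parcs G"
  using proper by (auto simp: proper_subconflict_graph_def subconflict_graph_def subgraph_def)

lemma fin_K: "pair_fin_digraph K"
  using subconflict(1) by (rule conflict_graph_wrt_fin)

text \<open>Equal in-degrees and inclusion of finite sets of incoming arcs force equality of these
  sets.\<close>

lemma arc_iff:
  assumes "(u', v) \<in> parcs K"
  shows "(u, v) \<in> parcs K \<longleftrightarrow> (u, v) \<in> parcs G"
proof -
  have "in_degree K v \<noteq> 0" "v \<in> pverts K"
    using assms in_degree_eq_0_iff[OF fin_K] arc_in_pverts[OF fin_K] by blast+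
  then have "in_degree K v = in_degree G v"
    using proper by (auto simp: proper_subconflict_graph_def subconflict_graph_def)
  moreover have "in_arcs K v \<subseteq> in_arcs G v" using subconflict(3) by auto
  moreover have "finite (in_arcs G v)"
    using pair_fin_digraph.pair_finite_arcs[OF fin_G] by (simp add: in_arcs_def)
  ultimately have "in_arcs K v = in_arcs G v"
    unfolding in_degree_def by (simp add: card_subset_eq)
  then show ?thesis by (auto simp: set_eq_iff)
qed

lemma Box_arc_iff: "(u, Box) \<in> parcs K \<longleftrightarrow> (u, Box) \<in> parcs G"
proof -
  have "\<exists>u'. (u', Box) \<in> parcs K" using subconflict(1) unfolding conflict_graph_wrt_def by blast
  then show ?thesis using arc_iff by blast
qed

lemma Lit_arc_iff: "l \<in> implied K \<Longrightarrow> (u, Lit l) \<in> parcs K \<longleftrightarrow> (u, Lit l) \<in> parcs G"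
  using arc_iff implied_iff[OF fin_K] by blast

lemma Lit_in_sub_iff: "Lit l \<in> pverts K \<longleftrightarrow> l \<in> {Pos x, Neg x} \<union> \<Union> (preds G ` implied K)"
proof -
  have "{u. (u, Box) \<in> parcs K} = {Lit (Pos x), Lit (Neg x)}" using Box_arc_iff Box_preds by simp
  moreover have "preds K a = preds G a" if "a \<in> implied K" for a
    using that Lit_arc_iff by (simp add: preds_def)
  ultimately show ?thesis using Lit_in_pverts_iff[OF subconflict(1)] by simp
qed

lemma leaves_sub: "leaves K = boundary (implied K)"
  using Lit_in_sub_iff by (auto simp: leaves_eq boundary_def)

lemma pverts_sub: "pverts K = insert Box (Lit ` ({Pos x, Neg x} \<union> \<Union> (preds G ` implied K)))"
proof (rule set_eqI)
  fix v
  have "Box \<in> pverts K" using subconflict(1) by (simp add: conflict_graph_wrt_def)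
  then show "v \<in> pverts K \<longleftrightarrow> v \<in> insert Box (Lit ` ({Pos x, Neg x} \<union> \<Union> (preds G ` implied K)))"
    using Lit_in_sub_iff by (cases v) auto
qed

lemma parcs_sub: "parcs K = {(u, v) \<in> parcs G. v \<in> insert Box (Lit ` implied K)}"
proof -
  have "(u, v) \<in> parcs K \<longleftrightarrow> (u, v) \<in> parcs G \<and> v \<in> insert Box (Lit ` implied K)" for u v
    proof (cases v)
    case Box
    then show ?thesis using Box_arc_iff by simp
  next
    case (Lit l)
    then show ?thesis using Lit_arc_iff[of l u] implied_iff[OF fin_K, of l] by auto
  qed
  then show ?thesis by auto
qed

text \<open>A literal of \<open>G\<close> that is not implied in \<open>K\<close> has a path to \<open>Box\<close>; the first node of this
  path lying in \<open>K\<close> is a leaf of \<open>K\<close>. Properness therefore forces \<open>implied K\<close> to be closed under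
  successors.\<close>

lemma path_to_leaf:
  assumes "Lit b \<in> pverts G" "b \<notin> implied K"
  shows "\<exists>l\<in>leaves K. Lit b \<rightarrow>\<^sup>*\<^bsub>G\<^esub> Lit l"
  using assms
proof (induction "card {w. (Lit b, w) \<in> (parcs G)\<^sup>+}" arbitrary: b rule: less_induct)
  case less
  interpret g: pair_fin_digraph G by (rule fin_G)
  show ?case
  proof (cases "Lit b \<in> pverts K")
    case True
    then show ?thesis using less.prems by (intro bexI[of _ b]) (auto simp: leaves_eq)
  next
    case False
    then obtain c where c: "c \<in> implied G" "b \<in> preds G c" "c \<notin> implied K"
      using less.prems Lit_in_sub_iff Lit_in_pverts_iff[OF G Box_preds] by blast
    then obtain l where "l \<in> leaves K" "Lit c \<rightarrow>\<^sup>*\<^bsub>G\<^esub> Lit l"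
      using less.hyps[of c] rank_less by (auto simp: implied_def)
    then show ?thesis using c(2) g.adj_reachable_trans unfolding preds_def by blast
  qed
qed

lemma up_set_implied: "up_set (implied K)"
  unfolding up_set_def
proof (intro conjI ballI impI)
  interpret g: pair_fin_digraph G by (rule fin_G)
  show "implied K \<subseteq> implied G"
    using implied_iff fin_K fin_G subconflict(3) by blast
  fix a b assume ab: "a \<in> implied K" "b \<in> implied G" "a \<in> preds G b"
  show "b \<in> implied K"
  proof (rule ccontr)
    assume "b \<notin> implied K"
    then obtain l where l: "l \<in> leaves K" "Lit b \<rightarrow>\<^sup>*\<^bsub>G\<^esub> Lit l"
      using path_to_leaf ab(2) by (auto simp: implied_def)
    then have "Lit a \<rightarrow>\<^sup>*\<^bsub>G\<^esub> Lit l"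
      using ab(3) g.adj_reachable_trans unfolding preds_def by blast
    then show False
      using proper ab(1) l(1) unfolding proper_subconflict_graph_def implied_def by blast
  qed
qed

text \<open>Paths in \<open>K\<close> to \<open>l\<close> avoid \<open>Box\<close>. Conversely, a
  path in \<open>G\<close> from an implied literal of \<open>K\<close> stays among these, as they
  form an up-set, and so uses only arcs of \<open>K\<close>.\<close>

lemma reachable_ancestors:
  assumes "l \<in> implied K"
  shows "Lit a \<rightarrow>\<^sup>*\<^bsub>K\<^esub> Lit l \<and> a \<in> implied K \<longleftrightarrow> a \<in> ancestors l \<inter> implied K"
proof
  interpret k: pair_fin_digraph K by (rule fin_K)
  have "\<And>b. v = Lit b \<Longrightarrow> b \<in> ancestors l" if "v \<rightarrow>\<^sup>*\<^bsub>K\<^esub> Lit l" for v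
    using that
  proof (induction rule: k.converse_reachable_induct)
    case base
    then show ?case by simp
  next
    case (step v w)
    have "w \<noteq> Box"
      using step(2) Box_no_out_arc[OF subconflict(1)] by (auto elim: k.converse_reachable_cases)
    then obtain c where c: "w = Lit c" by (cases w) auto
    then have "(Lit b, Lit c) \<in> parcs G" using step(1,4) subconflict(3) by blast
    then have "c \<in> implied G" "b \<in> preds G c" using implied_iff[OF fin_G] by (auto simp: preds_def)
    then show ?case using pred_ancestor step(3)[OF c] by blast
  qed
  then show "a \<in> ancestors l \<inter> implied K" if "Lit a \<rightarrow>\<^sup>*\<^bsub>K\<^esub> Lit l \<and> a \<in> implied K"
    using that by blast
  assume "a \<in> ancestors l \<inter> implied K"
  then have "a \<in> ancestors l" "a \<in> implied K" by auto
  then have "Lit a \<rightarrow>\<^sup>*\<^bsub>K\<^esub> Lit l"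
    unfolding ancestors_def mem_Collect_eq
  proof (induction rule: converse_rtrancl_induct)
    case base
    then show ?case using assms by (auto simp: implied_def)
  next
    case (step a b)
    then have "b \<in> implied K" using up_set_implied by (auto simp: up_set_def)
    then show ?case using step Lit_arc_iff k.adj_reachable_trans unfolding preds_def by blast
  qed
  with \<open>a \<in> implied K\<close> show "Lit a \<rightarrow>\<^sup>*\<^bsub>K\<^esub> Lit l \<and> a \<in> implied K" by blast
qed

lemma IC_eq_induced:
  assumes "l \<in> implied K"
  shows "IC l K = induced (implied K) l"
proof -
  interpret k: pair_fin_digraph K by (rule fin_K)
  have "a \<in> leaves (graph_to K l) \<longleftrightarrow> a \<in> \<Union> (preds G ` (ancestors l \<inter> implied K)) - implied K" for a
  proof -
    \<comment> \<open>Predecessors of a node that reaches \<open>l\<close> also reach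
      \<open>l\<close>, so the leaves of the subgraph are the leaves of \<open>K\<close> that reach
      \<open>l\<close>.\<close>
    have "in_arcs (graph_to K l) (Lit a) = in_arcs K (Lit a)" if "Lit a \<rightarrow>\<^sup>*\<^bsub>K\<^esub> Lit l"
      using that k.adj_reachable_trans by (auto simp: graph_to_def)
    then have "a \<in> leaves (graph_to K l) \<longleftrightarrow> Lit a \<rightarrow>\<^sup>*\<^bsub>K\<^esub> Lit l \<and> a \<notin> implied K"
      using k.reachable_in_verts(1)
      by (auto simp: leaves_def graph_to_def implied_def in_degree_def)
    also have "\<dots> \<longleftrightarrow> a \<in> \<Union> (preds G ` (ancestors l \<inter> implied K)) - implied K"
    proof
      assume a: "Lit a \<rightarrow>\<^sup>*\<^bsub>K\<^esub> Lit l \<and> a \<notin> implied K"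
      then have "Lit a \<noteq> Lit l" using assms by auto
      with a obtain w where w: "(Lit a, w) \<in> parcs K" "w \<rightarrow>\<^sup>*\<^bsub>K\<^esub> Lit l"
        by (auto elim: k.converse_reachable_cases)
      have "w \<noteq> Box"
        using w(2) Box_no_out_arc[OF subconflict(1)] by (auto elim: k.converse_reachable_cases)
      then obtain b where b: "w = Lit b" by (cases w) auto
      then have "b \<in> implied K" using w(1) implied_iff[OF fin_K] by blast
      moreover have "b \<in> ancestors l" using reachable_ancestors[OF assms] calculation w(2) b by blast
      moreover have "a \<in> preds G b" using w(1) subconflict(3) b by (auto simp: preds_def)
      ultimately show "a \<in> \<Union> (preds G ` (ancestors l \<inter> implied K)) - implied K" using a by blast
    next
      assume "a \<in> \<Union> (preds G ` (ancestors l \<inter> implied K)) - implied K"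
      then obtain b where b: "b \<in> ancestors l \<inter> implied K" "a \<in> preds G b" "a \<notin> implied K"
        by blast
      then have "(Lit a, Lit b) \<in> parcs K" using Lit_arc_iff by (auto simp: preds_def)
      moreover have "Lit b \<rightarrow>\<^sup>*\<^bsub>K\<^esub> Lit l" using reachable_ancestors[OF assms] b(1) by blast
      ultimately show "Lit a \<rightarrow>\<^sup>*\<^bsub>K\<^esub> Lit l \<and> a \<notin> implied K"
        using k.adj_reachable_trans b(3) by simp
    qed
    finally show ?thesis .
  qed
  then have "leaves (graph_to K l) = \<Union> (preds G ` (ancestors l \<inter> implied K)) - implied K"
    by blast
  then show ?thesis unfolding IC_def induced_def by auto
qed

end

lemma proper_subconflict_graph_eqI:
  assumes "proper_subconflict_graph F K G" "proper_subconflict_graph F K' G"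
    and "implied K = implied K'"
  shows "K = K'"
  using pverts_sub[OF assms(1)] pverts_sub[OF assms(2)] parcs_sub[OF assms(1)]
    parcs_sub[OF assms(2)] assms(3) by (intro pair_pre_digraph.equality) auto

lemma implied_mono:
  assumes "proper_subconflict_graph F K G" "proper_subconflict_graph F K' G" "strict_subgraph K K'"
  shows "implied K \<subset> implied K'"
proof -
  have "parcs K \<subseteq> parcs K'" using assms(3) by (auto simp: strict_subgraph_def subgraph_def)
  then have "implied K \<subseteq> implied K'"
    using implied_iff[OF fin_K[OF assms(1)]] implied_iff[OF fin_K[OF assms(2)]] by blast
  moreover have "implied K \<noteq> implied K'"
    using proper_subconflict_graph_eqI assms by (auto simp: strict_subgraph_def)
  ultimately show ?thesis by blast
qed

end

section \<open>Induction along the decomposition\<close>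

theorem theorem5p1:
  fixes F :: "'v clause set" and \<alpha> :: "'v assignment" and G :: "'v graph" and n k :: nat
    and H :: "nat \<Rightarrow> 'v graph" and m :: "nat \<Rightarrow> nat" and K :: "nat \<Rightarrow> nat \<Rightarrow> 'v graph"
  assumes "\<forall>C\<in>F. finite C"
    and "conflict_graph F \<alpha> G"
    and "card (pverts G) = n"
    and "series_parallel_decomposition F G k H m K"
  shows "\<exists>T. regWRTI F T \<and> num_nodes T \<le> n ^ 2 \<and>
           (\<forall>C\<in>learnable_clauses k H m K. C \<in> input_derived_clauses T) \<and>
           root_clause T = CC G \<and>
           (\<forall>x\<in>res_vars T. \<exists>l. Lit l \<in> pverts G \<and> l \<notin> leaves G \<and> var l = x)"
proof -
  obtain x where Box: "{u. (u, Box) \<in> parcs G} = {Lit (Pos x), Lit (Neg x)}"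
    using assms(2) unfolding conflict_graph_def conflict_graph_wrt_def by blast
  interpret conflict_graph_locale F "\<lambda>l. lit_val \<alpha> l = Some True" G x
    using assms(2) Box by unfold_locales (auto simp: conflict_graph_def)
  have dec: "1 \<le> k" "H k = G" "\<And>i. i \<le> k \<Longrightarrow> proper_subconflict_graph F (H i) G"
    "\<And>i. i < k \<Longrightarrow> strict_subgraph (H i) (H (Suc i))"
    using assms(4) by (auto simp: series_parallel_decomposition_def decomposition_def)
  have ref: "K i 0 = H i" "K i (m i) = H (Suc i)"
    "\<And>j. j \<le> m i \<Longrightarrow> proper_subconflict_graph F (K i j) G"
    "\<And>j. j < m i \<Longrightarrow> strict_subgraph (K i j) (K i (Suc j))" if "i < k" for i
    using assms(4) that by (auto simp: series_parallel_decomposition_def)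
  let ?W = "\<lambda>i j. implied (K i j)"
  have up: "up_set (?W i j)" if "i < k" "j \<le> m i" for i j
    using up_set_implied ref(3) that by blast
  have mono: "?W i j \<subset> ?W i (Suc j)" if "i < k" "j < m i" for i j
    using implied_mono ref(3,4) that by simp
  have "0 < k" using dec(1) by simp
  \<comment> \<open>Otherwise \<open>H 0\<close> and \<open>H 1\<close> would coincide.\<close>
  have "m 0 \<noteq> 0"
    using ref(1,2)[OF \<open>0 < k\<close>] dec(4)[OF \<open>0 < k\<close>] unfolding strict_subgraph_def by metis
  then have m0: "1 \<le> m 0" by simp
  have "?W 0 1 \<noteq> {}" using mono[of 0 0] m0 \<open>0 < k\<close> by auto
  then obtain t T1 where t: "t \<in> ?W 0 (m 0)" "var t = x"
    and T1: "regular_derivation F T1" "root_clause T1 = neg ` boundary (?W 0 (m 0))"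
      "res_vars T1 \<subseteq> var ` (?W 0 (m 0) - {t})" "num_nodes T1 \<le> (card (?W 0 (m 0)) + 1)\<^sup>2"
      "\<forall>j. 1 \<le> j \<longrightarrow> j \<le> m 0 \<longrightarrow> neg ` boundary (?W 0 j) \<in> input_derived_clauses T1"
    using series_start[where W = "?W 0" and m = "m 0"] up mono m0 \<open>0 < k\<close> by blast
  \<comment> \<open>The literal \<open>t\<close> from the first chain remains the excluded pivot in
    all later steps.\<close>
  have tH: "t \<in> implied (H i)" if "1 \<le> i" "i \<le> k" for i
    using that
  proof (induction i rule: dec_induct)
    case base
    then show ?case using t(1) ref(2)[OF \<open>0 < k\<close>] by simp
  next
    case (step i)
    then have "i < k" "t \<in> implied (H i)" by auto
    then show ?case using implied_mono[OF dec(3)[of i] dec(3)[of "Suc i"] dec(4)[of i]] by auto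
  qed
  have "\<exists>T. regular_derivation F T \<and> root_clause T = neg ` boundary (implied (H i)) \<and>
      res_vars T \<subseteq> var ` (implied (H i) - {t}) \<and> num_nodes T \<le> (card (implied (H i)) + 1)\<^sup>2 \<and>
      (\<forall>j. 1 \<le> j \<longrightarrow> j \<le> m 0 \<longrightarrow> neg ` boundary (?W 0 j) \<in> input_derived_clauses T) \<and>
      (\<forall>i'. 0 < i' \<longrightarrow> i' < i \<longrightarrow> (\<forall>j\<le>m i'. \<forall>l\<in>boundary (implied (H i')) \<inter> ?W i' j.
         induced (?W i' j) l \<in> input_derived_clauses T))" if "1 \<le> i" "i \<le> k" for i
    using that
  proof (induction i rule: dec_induct)
    case base
    then show ?case using T1 ref(2)[OF \<open>0 < k\<close>] by (intro exI[of _ T1]) simp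
  next
    case (step i)
    then have i: "i < k" "1 \<le> i" by auto
    obtain T where T: "regular_derivation F T" "root_clause T = neg ` boundary (implied (H i))"
      "res_vars T \<subseteq> var ` (implied (H i) - {t})" "num_nodes T \<le> (card (implied (H i)) + 1)\<^sup>2"
      "\<forall>j. 1 \<le> j \<longrightarrow> j \<le> m 0 \<longrightarrow> neg ` boundary (?W 0 j) \<in> input_derived_clauses T"
      "\<forall>i'. 0 < i' \<longrightarrow> i' < i \<longrightarrow> (\<forall>j\<le>m i'. \<forall>l\<in>boundary (implied (H i')) \<inter> ?W i' j.
         induced (?W i' j) l \<in> input_derived_clauses T)"
      using step.IH i by auto
    have "\<exists>T'. regular_derivation F T' \<and> root_clause T' = neg ` boundary (?W i (m i)) \<and>
        res_vars T' \<subseteq> var ` (?W i (m i) - {t}) \<and> num_nodes T' \<le> (card (?W i (m i)) + 1)\<^sup>2 \<and>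
        set (postorder T) \<subseteq> set (postorder T') \<and>
        (\<forall>j\<le>m i. \<forall>l\<in>boundary (?W i 0) \<inter> ?W i j. induced (?W i j) l \<in> input_derived_clauses T')"
      by (rule parallel_step)
        (use up mono i t(2) tH[of i] T(1-4) ref(1)[OF i(1)] in \<open>auto simp: psubset_imp_subset\<close>)
    then obtain T' where T': "regular_derivation F T'"
      "root_clause T' = neg ` boundary (implied (H (Suc i)))"
      "res_vars T' \<subseteq> var ` (implied (H (Suc i)) - {t})"
      "num_nodes T' \<le> (card (implied (H (Suc i))) + 1)\<^sup>2"
      "set (postorder T) \<subseteq> set (postorder T')"
      "\<forall>j\<le>m i. \<forall>l\<in>boundary (implied (H i)) \<inter> ?W i j. induced (?W i j) l \<in> input_derived_clauses T'"
      unfolding ref(1,2)[OF i(1)] by blast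
    have "input_derived_clauses T \<subseteq> input_derived_clauses T'"
      using T'(5) by (auto simp: input_derived_clauses_def)
    then show ?case
      using T' T(5,6) by (intro exI[of _ T']) (auto simp: less_Suc_eq)
  qed
  from this[of k] obtain T where T: "regular_derivation F T"
    "root_clause T = neg ` boundary (implied G)"
    "res_vars T \<subseteq> var ` (implied G - {t})" "num_nodes T \<le> (card (implied G) + 1)\<^sup>2"
    "\<forall>j. 1 \<le> j \<longrightarrow> j \<le> m 0 \<longrightarrow> neg ` boundary (?W 0 j) \<in> input_derived_clauses T"
    "\<forall>i. 0 < i \<longrightarrow> i < k \<longrightarrow> (\<forall>j\<le>m i. \<forall>l\<in>boundary (implied (H i)) \<inter> ?W i j.
       induced (?W i j) l \<in> input_derived_clauses T)"
    using dec(1,2) by auto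
  have proper_G: "proper_subconflict_graph F G G" using dec(2) dec(3)[of k] by simp
  \<comment> \<open>The additional node is \<open>Box\<close>.\<close>
  have "card (implied G) + 1 \<le> n"
  proof -
    have "insert Box (Lit ` implied G) \<subseteq> pverts G"
      using assms(2) by (auto simp: implied_def conflict_graph_def conflict_graph_wrt_def)
    then have "card (insert Box (Lit ` implied G)) \<le> n"
      using assms(3) card_mono pair_fin_digraph.pair_finite_verts[OF fin_G] by blast
    moreover have "card (insert Box (Lit ` implied G)) = card (implied G) + 1"
      using finite_N by (subst card_insert_disjoint) (auto simp: card_image inj_on_def)
    ultimately show ?thesis by simp
  qed
  then have "num_nodes T \<le> n ^ 2" using T(4) power_mono order_trans by blast
  moreover have "C \<in> input_derived_clauses T" if "C \<in> learnable_clauses k H m K" for C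
    using that unfolding learnable_clauses_def
  proof (elim UnE CollectE exE conjE)
    fix j assume "C = CC (K 0 j)" "1 \<le> j" "j \<le> m 0"
    then show ?thesis using T(5) leaves_sub ref(3)[OF \<open>0 < k\<close>] by (simp add: CC_eq)
  next
    fix i j l
    assume C: "C = IC l (K i j)" and ij: "0 < i" "i < k" "0 < j" "j \<le> m i"
      and l: "l \<in> leaves (H i) - leaves (K i j)"
    have "?W i 0 \<subseteq> ?W i j'" if "j' \<le> m i" for j'
      using that
    proof (induction j')
      case (Suc j')
      then show ?case using mono[of i j'] ij by auto
    qed simp
    then have "implied (H i) \<subseteq> ?W i j" using ij ref(1) by simp
    \<comment> \<open>A leaf of \<open>H i\<close> is also a node of \<open>K i j\<close>; not being
      a leaf there, it is implied.\<close>
    then have lb: "l \<in> boundary (implied (H i)) \<inter> ?W i j"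
      using l leaves_sub[OF dec(3)[of i]] leaves_sub[OF ref(3)] ij by (auto simp: boundary_def)
    then show ?thesis using C IC_eq_induced[OF ref(3)] T(6) ij by auto
  qed
  moreover have "root_clause T = CC G" using T(2) leaves_sub[OF proper_G] by (simp add: CC_eq)
  moreover have "\<exists>l. Lit l \<in> pverts G \<and> l \<notin> leaves G \<and> var l = y" if "y \<in> res_vars T" for y
    using that T(3) by (auto simp: leaves_eq implied_def)
  ultimately show ?thesis using regular_derivation_imp_regWRTI[OF T(1)] by blast
qed

end
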